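(* Let $\|\cdot\|$ be a norm on $\mathbb{R}^d$ (the source norm), with associated Capra coupling $c$, and with associated families $\{\|\cdot\|^{\mathrm{tn}}_{\star,(K)}\}_{K\subset V}$ of generalized local-top-$K$ dual norms and $\{\|\cdot\|^{\star\mathrm{sn}}_{\star,(K)}\}_{K\subset V}$ of generalized local-$K$-support dual norms. Suppose that both the norm $\|\cdot\|$ and its dual norm $\|\cdot\|_\star$ are orthant-strictly monotonic. For any nondecreasing finite-valued set function $F:2^V\to\mathbb{R}$, the following statements hold true. (i) The function $\mathcal{L}_0^F:\mathbb{R}^d\to\overline{\mathbb{R}}$ defined by $\mathcal{L}_0^F=\big((F\circ\mathrm{supp})^c\big)^{\star'}$ is proper convex lower semicontinuous (lsc). (ii) $F\circ\mathrm{supp}$ coincides with $\mathcal{L}_0^F$ on the unit sphere $\mathbb{S}=\{x\in\mathbb{R}^d:\|x\|=1\}$: $F(\mathrm{supp}(x))=\mathcal{L}_0^F(x)$ for all $x\in\mathbb{S}$. (iii) $F(\mathrm{supp}(x))=\mathcal{L}_0^F\big(x/\|x\|\big)$ for all $x\in\mathbb{R}^d\setminus\{0\}$. (iv) $\mathcal{L}_0^F=\Big(\sup_{K\subset V}\big[\|\cdot\|^{\mathrm{tn}}_{\star,(K)}-F(K)\big]\Big)^{\star'}$. (v) $\mathcal{L}_0^F$ is the largest proper convex lsc function below the function $x\in\mathbb{R}^d\mapsto\inf\{F(K): K\subset V,\ x\in\mathbb{B}_K\}$. (vi) $\mathcal{L}_0^F$ is the largest proper convex lsc function below the function $x\in\mathbb{R}^d\mapsto\inf\{F(K):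 K\subset V,\ x\in\mathbb{S}_K\}$. (vii) For all $x\in\mathbb{R}^d$, $$\mathcal{L}_0^F(x)=\min_{\lambda\in\Delta_V,\ x\in\sum_{K\subset V}\lambda_K\mathbb{B}_K}\ \sum_{K\subset V}\lambda_KF(K)=\min_{\lambda\in\Delta_V,\ x\in\sum_{K\subset V}\lambda_K\mathbb{S}_K}\ \sum_{K\subset V}\lambda_KF(K),$$ and, if $F(\emptyset)=0$, for all $x\in\mathbb{R}^d$, $$\mathcal{L}_0^F(x)=\min_z\ \sum_{\emptyset\subsetneq K\subset V}\|z_{(K)}\|^{\star\mathrm{sn}}_{\star,(K)}F(K),$$ where the minimum is over all families $z=\{z_{(K)}\}_{\emptyset\subsetneq K\subset V}$ with $z_{(K)}\in\mathcal{R}_K$, $\sum_{\emptyset\subsetneq K\subset V}\|z_{(K)}\|^{\star\mathrm{sn}}_{\star,(K)}\le 1$ and $\sum_{\emptyset\subsetneq K\subset V}z_{(K)}=x$.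
   Context: $d\ge 1$ is an integer, $V=\{1,\ldots,d\}$, $\langle\cdot,\cdot\rangle$ is the standard scalar product on $\mathbb{R}^d$, $\overline{\mathbb{R}}=[-\infty,+\infty]$. The support mapping is $\mathrm{supp}(x)=\{j\in V: x_j\neq 0\}$. $F$ is nondecreasing if $J\subset K\subset V$ implies $F(J)\le F(K)$. For $K\subset V$, $\mathcal{R}_K=\{x\in\mathbb{R}^d: x_j=0\ \forall j\notin K\}$ (so $\mathcal{R}_\emptyset=\{0\}$), and $y_K$ is the orthogonal projection of $y\in\mathbb{R}^d$ on $\mathcal{R}_K$. The dual norm is $\|y\|_\star=\sup_{\|x\|\le 1}\langle x,y\rangle$. A norm $N$ on $\mathbb{R}^d$ is orthant-strictly monotonic if for all $x,x'\in\mathbb{R}^d$: if $|x_i|\le|x'_i|$ for all $i$ with at least one strict inequality, and $x_ix'_i\ge 0$ for all $i$, then $N(x)<N(x')$. The generalized local-top-$K$ dual norm is the norm on $\mathcal{R}_K$ given by $\|y\|^{\mathrm{tn}}_{\star,(K)}=\sup_{J\subset K}\|y_J\|_\star$; it is extended to a seminorm on $\mathbb{R}^d$ by $\|y\|^{\mathrm{tn}}_{\star,(K)}=\|y_K\|^{\mathrm{tn}}_{\star,(K)}$, with the convention $\|\cdot\|^{\mathrm{tn}}_{\star,(\emptyset)}=0$. The generalized local-$K$-support dual norm is the dual norm of the former on the subspace $\mathcal{R}_K$: $\|x\|^{\star\mathrm{sn}}_{\star,(K)}=\sup\{\langle x,y\rangle: y\in\mathcal{R}_K,\ \|y\|^{\mathrm{tn}}_{\star,(K)}\le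 1\}$ for $x\in\mathcal{R}_K$. Its unit ball and unit sphere are $\mathbb{B}_K=\{x\in\mathcal{R}_K:\|x\|^{\star\mathrm{sn}}_{\star,(K)}\le1\}$ and $\mathbb{S}_K=\{x\in\mathcal{R}_K:\|x\|^{\star\mathrm{sn}}_{\star,(K)}=1\}$, with the conventions $\mathbb{B}_\emptyset=\mathbb{S}_\emptyset=\{0\}$. $\Delta_V$ is the set of families $\lambda=\{\lambda_K\}_{K\subset V}$ of nonnegative reals with $\sum_{K\subset V}\lambda_K=1$; sums of sets are Minkowski sums. By convention $\inf\emptyset=+\infty$ (and a minimum over an empty set is $+\infty$). The Capra coupling is $c(x,y)=\langle x,y\rangle/\|x\|$ if $x\ne 0$, and $c(0,y)=0$. With the lower addition $\dot{+}_{\mathrm{low}}$ extending $+$ to $\overline{\mathbb{R}}$ by $(+\infty)\dot{+}_{\mathrm{low}}(-\infty)=(-\infty)\dot{+}_{\mathrm{low}}(+\infty)=-\infty$, the $c$-conjugate of $f:\mathbb{R}^d\to\overline{\mathbb{R}}$ is $f^c(y)=\sup_{x\in\mathbb{R}^d}\big(c(x,y)\dot{+}_{\mathrm{low}}(-f(x))\big)$ and the (reverse) Fenchel conjugate of $g:\mathbb{R}^d\to\overline{\mathbb{R}}$ is $g^{\star'}(x)=\sup_{y\in\mathbb{R}^d}\big(\langle x,y\rangle\dot{+}_{\mathrm{low}}(-g(y))\big)$. A function is proper if it never takes the value $-\infty$ and is not identically $+\infty$. *)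

theory Defs
  imports "HOL-Analysis.Analysis"
begin

(* The index set {1..d}, d >= 1, is an arbitrary type 'n of class finite, and R^d is real^'n.
   Norms other than the Euclidean one are functions N :: real^'n => real satisfying is_norm. *)

definition is_norm :: "(real^'n \<Rightarrow> real) \<Rightarrow> bool" where
  "is_norm N \<longleftrightarrow> (\<forall>x. 0 \<le> N x) \<and> (\<forall>x. N x = 0 \<longleftrightarrow> x = 0) \<and>
     (\<forall>a x. N (a *\<^sub>R x) = \<bar>a\<bar> * N x) \<and> (\<forall>x y. N (x + y) \<le> N x + N y)"

definition dual_norm :: "(real^'n \<Rightarrow> real) \<Rightarrow> real^'n \<Rightarrow> real" where
  "dual_norm N y = (SUP x\<in>{x. N x \<le> 1}. x \<bullet> y)"

definition orthant_strictly_monotonic :: "(real^'n \<Rightarrow> real) \<Rightarrow> bool" where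
  "orthant_strictly_monotonic N \<longleftrightarrow>
     (\<forall>x x'. (\<forall>i. \<bar>x $ i\<bar> \<le> \<bar>x' $ i\<bar>) \<and> (\<exists>i. \<bar>x $ i\<bar> < \<bar>x' $ i\<bar>) \<and> (\<forall>i. 0 \<le> x $ i * x' $ i)
        \<longrightarrow> N x < N x')"

definition supp :: "real^'n \<Rightarrow> 'n set" where
  "supp x = {j. x $ j \<noteq> 0}"

definition coord_subspace :: "'n set \<Rightarrow> (real^'n) set" where
  "coord_subspace K = {x. \<forall>j. j \<notin> K \<longrightarrow> x $ j = 0}"

(* closest_point is taken with respect to the Euclidean distance *)
definition proj :: "'n set \<Rightarrow> real^'n \<Rightarrow> real^'n" where
  "proj K y = closest_point (coord_subspace K) y"

lemma proj_eq:
  fixes y :: "real^'n"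
  shows "proj K y = (\<chi> j. if j \<in> K then y $ j else 0)"
proof -
  let ?p = "(\<chi> j. if j \<in> K then y $ j else 0) :: real^'n"
  have eq: "coord_subspace K = (\<Inter>j\<in>-K. {x. x $ j = 0})"
    by (auto simp: coord_subspace_def)
  have cl: "closed (coord_subspace K)"
    unfolding eq by (intro closed_INT ballI closed_Collect_eq continuous_intros)
  have cv: "convex (coord_subspace K)"
    by (auto simp: coord_subspace_def convex_def)
  have "dist y ?p \<le> dist y z" if "z \<in> coord_subspace K" for z
    unfolding dist_vec_def
    by (rule L2_set_mono) (use that in \<open>auto simp: coord_subspace_def dist_real_def\<close>)
  moreover have "?p \<in> coord_subspace K"
    by (auto simp: coord_subspace_def)
  ultimately show ?thesis
    unfolding proj_def using closest_point_unique[OF cv cl] by metis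
qed

(* The seminorm on the whole space; for y in coord_subspace K, proj K y = y.  For K = {} it is
   identically 0, see local_top_dual_norm_empty. *)
definition local_top_dual_norm :: "(real^'n \<Rightarrow> real) \<Rightarrow> 'n set \<Rightarrow> real^'n \<Rightarrow> real" where
  "local_top_dual_norm N K y = (SUP J\<in>Pow K. dual_norm N (proj J (proj K y)))"

(* Only meaningful for x in coord_subspace K. *)
definition local_support_dual_norm :: "(real^'n \<Rightarrow> real) \<Rightarrow> 'n set \<Rightarrow> real^'n \<Rightarrow> real" where
  "local_support_dual_norm N K x =
     (SUP y\<in>{y \<in> coord_subspace K. local_top_dual_norm N K y \<le> 1}. x \<bullet> y)"

definition local_ball :: "(real^'n \<Rightarrow> real) \<Rightarrow> 'n set \<Rightarrow> (real^'n) set" where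
  "local_ball N K =
     (if K = {} then {0} else {x \<in> coord_subspace K. local_support_dual_norm N K x \<le> 1})"

definition local_sphere :: "(real^'n \<Rightarrow> real) \<Rightarrow> 'n set \<Rightarrow> (real^'n) set" where
  "local_sphere N K =
     (if K = {} then {0} else {x \<in> coord_subspace K. local_support_dual_norm N K x = 1})"

lemma local_top_dual_norm_empty:
  fixes N :: "real^'n \<Rightarrow> real"
  assumes "is_norm N"
  shows "local_top_dual_norm N {} y = 0"
proof -
  have "proj {} z = 0" for z :: "real^'n"
    by (simp add: proj_eq vec_eq_iff)
  moreover have "N 0 = 0"
    using assms by (simp add: is_norm_def)
  then have "{x. N x \<le> 1} \<noteq> {}"
    by (metis (mono_tags, lifting) empty_iff mem_Collect_eq zero_le_one)
  ultimately show ?thesis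
    by (simp add: local_top_dual_norm_def dual_norm_def)
qed

(* On ereal, the library's + satisfies \<infinity> + (-\<infinity>) = \<infinity>, whence the case distinction. *)
definition lower_add :: "ereal \<Rightarrow> ereal \<Rightarrow> ereal" where
  "lower_add a b = (if a = -\<infinity> \<or> b = -\<infinity> then -\<infinity> else a + b)"

definition capra :: "(real^'n \<Rightarrow> real) \<Rightarrow> real^'n \<Rightarrow> real^'n \<Rightarrow> real" where
  "capra N x y = (if x = 0 then 0 else (x \<bullet> y) / N x)"

definition capra_conjugate :: "(real^'n \<Rightarrow> real) \<Rightarrow> (real^'n \<Rightarrow> ereal) \<Rightarrow> real^'n \<Rightarrow> ereal" where
  "capra_conjugate N f y = (SUP x. lower_add (ereal (capra N x y)) (- f x))"

definition fenchel_conjugate :: "(real^'n \<Rightarrow> ereal) \<Rightarrow> real^'n \<Rightarrow> ereal" where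
  "fenchel_conjugate g x = (SUP y. lower_add (ereal (x \<bullet> y)) (- g y))"

definition L0 :: "(real^'n \<Rightarrow> real) \<Rightarrow> ('n set \<Rightarrow> real) \<Rightarrow> real^'n \<Rightarrow> ereal" where
  "L0 N F = fenchel_conjugate (capra_conjugate N (\<lambda>x. ereal (F (supp x))))"

definition proper_fun :: "(real^'n \<Rightarrow> ereal) \<Rightarrow> bool" where
  "proper_fun f \<longleftrightarrow> (\<forall>x. f x \<noteq> -\<infinity>) \<and> (\<exists>x. f x \<noteq> \<infinity>)"

definition convex_fun :: "(real^'n \<Rightarrow> ereal) \<Rightarrow> bool" where
  "convex_fun f \<longleftrightarrow> convex {(x, t :: real). f x \<le> ereal t}"

definition lsc_fun :: "(real^'n \<Rightarrow> ereal) \<Rightarrow> bool" where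
  "lsc_fun f \<longleftrightarrow> (\<forall>x. f x \<le> Liminf (at x) f)"

definition proper_convex_lsc :: "(real^'n \<Rightarrow> ereal) \<Rightarrow> bool" where
  "proper_convex_lsc f \<longleftrightarrow> proper_fun f \<and> convex_fun f \<and> lsc_fun f"

(* The order on functions is the pointwise one. *)
definition largest_proper_convex_lsc_below ::
    "(real^'n \<Rightarrow> ereal) \<Rightarrow> (real^'n \<Rightarrow> ereal) \<Rightarrow> bool" where
  "largest_proper_convex_lsc_below g f \<longleftrightarrow>
     proper_convex_lsc g \<and> g \<le> f \<and> (\<forall>h. proper_convex_lsc h \<and> h \<le> f \<longrightarrow> h \<le> g)"

definition simplex_weights :: "('n::finite set \<Rightarrow> real) set" where
  "simplex_weights = {l. (\<forall>K. 0 \<le> l K) \<and> (\<Sum>K\<in>UNIV. l K) = 1}"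

(* The sum over K is the Minkowski sum of sets from HOL-Library.Set_Algebras. *)
definition weighted_set_sum ::
    "('n::finite set \<Rightarrow> real) \<Rightarrow> ('n set \<Rightarrow> (real^'n) set) \<Rightarrow> (real^'n) set" where
  "weighted_set_sum l A = (\<Sum>K\<in>UNIV. (\<lambda>v. l K *\<^sub>R v) ` A K)"

(* m is the minimum of A: attained if A is nonempty, and \<infinity> by convention if A is empty. *)
definition is_minimum :: "ereal \<Rightarrow> ereal set \<Rightarrow> bool" where
  "is_minimum m A \<longleftrightarrow> (if A = {} then m = \<infinity> else m \<in> A \<and> (\<forall>a\<in>A. m \<le> a))"

(* Admissible families (z K) for nonempty K; the value z {} is irrelevant. *)
definition decompositions :: "(real^'n \<Rightarrow> real) \<Rightarrow> real^'n \<Rightarrow> ('n::finite set \<Rightarrow> real^'n) set" where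
  "decompositions N x = {z. (\<forall>K\<in>-{{}}. z K \<in> coord_subspace K) \<and>
     (\<Sum>K\<in>-{{}}. local_support_dual_norm N K (z K)) \<le> 1 \<and> (\<Sum>K\<in>-{{}}. z K) = x}"

end

theory Submission
  imports Defs
begin

text \<open>
  Since the source norm \<open>N\<close> is orthant-monotonic, coordinate projections do not increase it. This
  collapses the local norms: the local top dual norm of index \<open>K\<close> is the support function of the
  part of the unit ball of \<open>N\<close> that lies in the coordinate subspace of \<open>K\<close>, and the local support
  norm is \<open>N\<close> itself on this subspace (\<open>local_support_dual_norm_eq\<close>). Hence, for
  nonempty \<open>K\<close>, the local balls and spheres are slices of the unit ball and of the unit sphere of
  \<open>N\<close>.

  Conjugating \<open>F \<circ> supp\<close> with respect to the Capra coupling then gives the maximum \<open>g\<close> over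
  \<open>K\<close> of the support functions of the local balls, each lowered by \<open>F K\<close>
  (\<open>conj_value\<close>, \<open>capra_conjugate_F_supp_eq\<close>). This is a finite function, so its Fenchel
  conjugate is a supremum of affine functions, hence convex and lsc, and it is at most \<open>F K\<close> on the ball of index \<open>K\<close>.

  In finite dimension \<open>g\<close> is also the conjugate of the convex hull of the constants \<open>F K\<close> placed
  on the balls. These balls are compact, so that the hull is closed and its lower boundary is attained; a
  separating hyperplane shows that this boundary is \<open>L0 N F\<close> (\<open>L0_ball_decomposition\<close>). The
  weight lost when the balls are replaced by spheres can be moved to the empty set, where \<open>F\<close> is
  smallest (\<open>L0_sphere_decomposition\<close>). All the minimum formulas follow, and so does maximality:
  a convex function that is at most \<open>F K\<close> on the sphere of index \<open>K\<close>, for all \<open>K\<close>, is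
  at most the mean of the \<open>F K\<close> at every convex combination of points of the spheres.

  On the unit sphere the strict monotonicity of both norms comes in: a norming functional of \<open>x\<close>
  can be chosen with the same support as \<open>x\<close>, and a large multiple of it is an affine
  minorant that reaches \<open>F (supp x)\<close> at \<open>x\<close> (\<open>L0_eq_on_unit_sphere\<close>).
\<close>


section \<open>Norms given as functions\<close>

lemma is_normD:
  fixes N :: "real^'n \<Rightarrow> real"
  assumes "is_norm N"
  shows is_norm_nonneg: "0 \<le> N x"
    and is_norm_eq_0: "N x = 0 \<longleftrightarrow> x = 0"
    and is_norm_zero: "N 0 = 0"
    and is_norm_scaleR: "N (a *\<^sub>R x) = \<bar>a\<bar> * N x"
    and is_norm_triangle: "N (x + y) \<le> N x + N y"
  using assms by (simp_all add: is_norm_def)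

lemma is_norm_pos:
  fixes N :: "real^'n \<Rightarrow> real"
  assumes "is_norm N" "x \<noteq> 0"
  shows "0 < N x"
  using is_norm_nonneg[OF assms(1), of x] is_norm_eq_0[OF assms(1), of x] assms(2) by linarith

lemma is_norm_normalize:
  fixes N :: "real^'n \<Rightarrow> real"
  assumes "is_norm N" "x \<noteq> 0"
  shows "N (x /\<^sub>R N x) = 1"
  using is_norm_pos[OF assms] by (simp add: is_norm_scaleR[OF assms(1)])

lemma convex_on_is_norm:
  fixes N :: "real^'n \<Rightarrow> real"
  assumes "is_norm N"
  shows "convex_on UNIV N"
proof (rule convex_onI)
  fix t :: real and x y :: "real^'n"
  assume "0 < t" "t < 1"
  then show "N ((1 - t) *\<^sub>R x + t *\<^sub>R y) \<le> (1 - t) * N x + t * N y"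
    using is_norm_triangle[OF assms, of "(1 - t) *\<^sub>R x" "t *\<^sub>R y"]
    by (simp add: is_norm_scaleR[OF assms])
qed simp

lemma continuous_on_is_norm:
  fixes N :: "real^'n \<Rightarrow> real"
  assumes "is_norm N"
  shows "continuous_on S N"
  using convex_on_continuous[OF open_UNIV convex_on_is_norm[OF assms]]
  by (rule continuous_on_subset) simp

lemma convex_is_norm_ball:
  fixes N :: "real^'n \<Rightarrow> real"
  assumes "is_norm N"
  shows "convex {x. N x \<le> r}" "convex {x. N x < r}"
proof -
  have le: "N (u *\<^sub>R x + v *\<^sub>R y) \<le> u * N x + v * N y"
    if "0 \<le> u" "0 \<le> v" "u + v = 1" for x y u v
    using convex_on_is_norm[OF assms] that by (simp add: convex_on_def)
  show "convex {x. N x \<le> r}" "convex {x. N x < r}"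
    by (intro convexI; simp, meson le convex_bound_le convex_bound_lt order_trans order_le_less_trans)+
qed

text \<open>By continuity \<open>N\<close> has a positive minimum on the Euclidean unit sphere, so that the unit ball
  of \<open>N\<close> is bounded.\<close>

lemma compact_is_norm_ball:
  fixes N :: "real^'n \<Rightarrow> real"
  assumes "is_norm N"
  shows "compact {x. N x \<le> r}"
proof -
  have "closed {x. N x \<le> r}"
    by (intro closed_Collect_le continuous_on_is_norm[OF assms] continuous_on_const)
  moreover have "bounded {x. N x \<le> r}"
  proof -
    obtain e :: "real^'n" where "e \<in> sphere 0 1"
      using vector_choose_size[of 1] by auto
    then obtain u where u: "u \<in> sphere 0 1" "\<And>x. x \<in> sphere 0 1 \<Longrightarrow> N u \<le> N x"
      using continuous_attains_inf[OF compact_sphere _ continuous_on_is_norm[OF assms]] by blast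
    have pos: "0 < N u"
      using u(1) by (intro is_norm_pos[OF assms]) auto
    have "norm x \<le> r / N u" if "N x \<le> r" for x
    proof (cases "x = 0")
      case True
      then show ?thesis using that pos is_norm_zero[OF assms] by simp
    next
      case False
      then have "N u \<le> N (x /\<^sub>R norm x)" by (intro u(2)) simp
      with False have "N u * norm x \<le> N x"
        by (simp add: is_norm_scaleR[OF assms] field_simps)
      with that pos show ?thesis by (simp add: field_simps)
    qed
    then show ?thesis by (auto simp: bounded_iff)
  qed
  ultimately show ?thesis by (simp add: compact_eq_bounded_closed)
qed

lemma dual_norm_attained:
  fixes N :: "real^'n \<Rightarrow> real"
  assumes "is_norm N"
  obtains x where "N x \<le> 1" "dual_norm N y = x \<bullet> y" "\<And>z. N z \<le> 1 \<Longrightarrow> z \<bullet> y \<le> x \<bullet> y"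
proof -
  have "{x. N x \<le> 1} \<noteq> {}" using is_norm_zero[OF assms] by (auto intro!: exI[of _ 0])
  then obtain x where x: "N x \<le> 1" "\<And>z. N z \<le> 1 \<Longrightarrow> z \<bullet> y \<le> x \<bullet> y"
    using continuous_attains_sup[OF compact_is_norm_ball[OF assms, of 1], of "\<lambda>x. x \<bullet> y"]
    by (auto simp: continuous_on_inner continuous_on_id)
  moreover have "dual_norm N y = x \<bullet> y"
    unfolding dual_norm_def using x by (intro cSup_eq_maximum) auto
  ultimately show thesis using that by blast
qed

lemma inner_le_dual_norm:
  fixes N :: "real^'n \<Rightarrow> real"
  assumes "is_norm N" "N x \<le> 1"
  shows "x \<bullet> y \<le> dual_norm N y"
  using dual_norm_attained[OF assms(1), of y] assms(2) by metis

lemma inner_le_is_norm_mult_dual_norm: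
  fixes N :: "real^'n \<Rightarrow> real"
  assumes "is_norm N"
  shows "x \<bullet> y \<le> N x * dual_norm N y"
proof (cases "x = 0")
  case False
  have "(x /\<^sub>R N x) \<bullet> y \<le> dual_norm N y"
    using is_norm_normalize[OF assms False] by (intro inner_le_dual_norm[OF assms]) simp
  then show ?thesis using is_norm_pos[OF assms False] by (simp add: field_simps)
qed (simp add: is_norm_zero[OF assms])

lemma dual_norm_scaleR:
  fixes N :: "real^'n \<Rightarrow> real"
  assumes "is_norm N" "0 \<le> t"
  shows "dual_norm N (t *\<^sub>R y) = t * dual_norm N y"
proof (rule antisym)
  obtain x where "N x \<le> 1" "dual_norm N (t *\<^sub>R y) = x \<bullet> (t *\<^sub>R y)"
    by (rule dual_norm_attained[OF assms(1), of "t *\<^sub>R y"])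
  then show "dual_norm N (t *\<^sub>R y) \<le> t * dual_norm N y"
    using assms by (simp add: inner_le_dual_norm mult_left_mono)
  obtain x where "N x \<le> 1" "dual_norm N y = x \<bullet> y"
    by (rule dual_norm_attained[OF assms(1), of y])
  then show "t * dual_norm N y \<le> dual_norm N (t *\<^sub>R y)"
    using inner_le_dual_norm[OF assms(1), of x "t *\<^sub>R y"] by simp
qed

text \<open>The Hahn--Banach theorem in finite dimension: a hyperplane separates a point of the unit
  sphere from the open unit ball.\<close>

lemma norming_functional_exists:
  fixes N :: "real^'n \<Rightarrow> real"
  assumes "is_norm N"
  obtains y where "dual_norm N y \<le> 1" "x \<bullet> y = N x"
proof (cases "x = 0")
  case True
  have "dual_norm N 0 = 0" using dual_norm_scaleR[OF assms, of 0 0] by simp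
  then show thesis using that[of 0] True is_norm_zero[OF assms] by simp
next
  case False
  define u where "u = x /\<^sub>R N x"
  have u: "N u = 1" unfolding u_def by (rule is_norm_normalize[OF assms False])
  have "{z. N z < 1} \<noteq> {}" using is_norm_zero[OF assms] by (auto intro!: exI[of _ 0])
  moreover have "{z. N z < 1} \<inter> {u} = {}" using u by auto
  ultimately obtain a b where a: "a \<noteq> 0" "\<And>z. N z < 1 \<Longrightarrow> a \<bullet> z \<le> b" "b \<le> a \<bullet> u"
    using separating_hyperplane_sets[OF convex_is_norm_ball(2)[OF assms, of 1] convex_singleton, of u]
    by auto
  have le: "z \<bullet> a \<le> u \<bullet> a" if "N z \<le> 1" for z
  proof (rule field_le_mult_one_interval)
    fix t :: real
    assume t: "0 < t" "t < 1"
    have "N (t *\<^sub>R z) < 1"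
      using t mult_left_mono[OF that, of t] unfolding is_norm_scaleR[OF assms] by linarith
    then have "a \<bullet> (t *\<^sub>R z) \<le> a \<bullet> u" using a(2,3) order_trans by blast
    then show "t * (z \<bullet> a) \<le> u \<bullet> a" by (simp add: inner_commute)
  qed
  have pos: "0 < u \<bullet> a"
  proof -
    have "0 < (a /\<^sub>R N a) \<bullet> a" using a(1) is_norm_pos[OF assms a(1)] by simp
    also have "\<dots> \<le> u \<bullet> a" using is_norm_normalize[OF assms a(1)] by (intro le) simp
    finally show ?thesis .
  qed
  obtain z where "N z \<le> 1" "dual_norm N a = z \<bullet> a"
    by (rule dual_norm_attained[OF assms, of a])
  then have "dual_norm N a \<le> u \<bullet> a" using le by simp
  moreover have "dual_norm N (a /\<^sub>R (u \<bullet> a)) = dual_norm N a / (u \<bullet> a)"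
    using pos by (simp add: dual_norm_scaleR[OF assms] divide_inverse_commute)
  ultimately have "dual_norm N (a /\<^sub>R (u \<bullet> a)) \<le> 1" using pos by simp
  moreover have "x \<bullet> a = N x * (u \<bullet> a)"
    using is_norm_pos[OF assms False] by (simp add: u_def)
  then have "x \<bullet> (a /\<^sub>R (u \<bullet> a)) = N x" using pos by (simp add: field_simps)
  ultimately show thesis by (rule that)
qed


section \<open>Coordinate projections\<close>

lemma proj_in_coord_subspace: "proj K x \<in> coord_subspace K"
  by (simp add: proj_eq coord_subspace_def)

lemma proj_ident: "x \<in> coord_subspace K \<Longrightarrow> proj K x = x"
  by (auto simp: proj_eq coord_subspace_def vec_eq_iff)

lemma coord_subspace_iff_supp: "x \<in> coord_subspace K \<longleftrightarrow> supp x \<subseteq> K"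
  by (auto simp: coord_subspace_def supp_def)

lemma proj_proj: "proj J (proj K x) = proj (J \<inter> K) x"
  by (simp add: proj_eq vec_eq_iff)

lemma proj_scaleR: "proj K (t *\<^sub>R x) = t *\<^sub>R proj K x"
  by (simp add: proj_eq vec_eq_iff)

lemma inner_proj_swap: "x \<bullet> proj K y = proj K x \<bullet> y"
  by (auto simp: proj_eq inner_vec_def intro!: sum.cong)

lemma scaleR_in_coord_subspace: "x \<in> coord_subspace K \<Longrightarrow> a *\<^sub>R x \<in> coord_subspace K"
  by (simp add: coord_subspace_def)

lemma subspace_coord_subspace: "subspace (coord_subspace K)"
  by (simp add: subspace_def coord_subspace_def)

lemma orthant_strictly_monotonicD:
  assumes "orthant_strictly_monotonic N"
    and "\<And>i. \<bar>x $ i\<bar> \<le> \<bar>x' $ i\<bar>" "\<bar>x $ j\<bar> < \<bar>x' $ j\<bar>" "\<And>i. 0 \<le> x $ i * x' $ i"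
  shows "N x < N x'"
  using assms unfolding orthant_strictly_monotonic_def by blast

lemma orthant_strictly_monotonic_proj_less:
  assumes "orthant_strictly_monotonic N" "\<not> supp x \<subseteq> K"
  shows "N (proj K x) < N x"
proof -
  obtain j where "x $ j \<noteq> 0" "j \<notin> K" using assms(2) by (auto simp: supp_def)
  then show ?thesis
    by (intro orthant_strictly_monotonicD[OF assms(1), where j = j]) (auto simp: proj_eq)
qed

lemma orthant_strictly_monotonic_proj_le:
  assumes "orthant_strictly_monotonic N"
  shows "N (proj K x) \<le> N x"
  using orthant_strictly_monotonic_proj_less[OF assms, of x K] proj_ident[of x K]
  by (fastforce simp: coord_subspace_iff_supp)


section \<open>Local norms of a projection-monotone norm\<close>

text \<open>Orthant monotonicity acts on the local norms through the following property, which passes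
  to the dual norm.\<close>

locale projection_monotone_norm =
  fixes N :: "real^'n \<Rightarrow> real"
  assumes norm: "is_norm N"
    and proj_le: "N (proj K x) \<le> N x"
begin

text \<open>Coordinate projections are self-adjoint.\<close>

lemma dual_norm_proj_le: "dual_norm N (proj K y) \<le> dual_norm N y"
proof -
  obtain x where "N x \<le> 1" "dual_norm N (proj K y) = x \<bullet> proj K y"
    by (rule dual_norm_attained[OF norm, of "proj K y"])
  then show ?thesis
    using inner_le_dual_norm[OF norm, of "proj K x" y] proj_le[of K x] by (simp add: inner_proj_swap)
qed

lemma local_top_dual_norm_eq: "local_top_dual_norm N K y = dual_norm N (proj K y)"
  unfolding local_top_dual_norm_def
proof (rule cSup_eq_maximum)
  show "dual_norm N (proj K y) \<in> (\<lambda>J. dual_norm N (proj J (proj K y))) ` Pow K"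
    by (rule image_eqI[of _ _ K]) (simp_all add: proj_proj)
qed (auto intro: dual_norm_proj_le)

lemma local_top_dual_norm_scaleR:
  "0 \<le> t \<Longrightarrow> local_top_dual_norm N K (t *\<^sub>R y) = t * local_top_dual_norm N K y"
  by (simp add: local_top_dual_norm_eq proj_scaleR dual_norm_scaleR[OF norm])

text \<open>A maximizer for the dual norm of the projection of \<open>y\<close> may itself be projected. So the local top
  norm is the support function of the part of the unit ball of \<open>N\<close> in the coordinate subspace: the
  next two lemmas give the bound and its attainment.\<close>

lemma inner_le_local_top_dual_norm:
  assumes "x \<in> coord_subspace K" "N x \<le> 1"
  shows "x \<bullet> y \<le> local_top_dual_norm N K y"
  using inner_le_dual_norm[OF norm assms(2), of "proj K y"] assms(1)
  by (simp add: local_top_dual_norm_eq inner_proj_swap proj_ident)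

lemma local_top_dual_norm_attained:
  obtains x where "x \<in> coord_subspace K" "N x \<le> 1" "local_top_dual_norm N K y = x \<bullet> y"
proof -
  obtain x where x: "N x \<le> 1" "dual_norm N (proj K y) = x \<bullet> proj K y"
    by (rule dual_norm_attained[OF norm, of "proj K y"])
  show thesis
  proof (rule that)
    show "proj K x \<in> coord_subspace K" by (rule proj_in_coord_subspace)
    show "N (proj K x) \<le> 1" using proj_le[of K x] x(1) by simp
    show "local_top_dual_norm N K y = proj K x \<bullet> y"
      using x(2) by (simp add: local_top_dual_norm_eq inner_proj_swap)
  qed
qed

text \<open>Dualizing twice gives back \<open>N\<close>: a norming functional of \<open>x\<close> may be projected on the coordinate
  subspace that contains \<open>x\<close>, which changes neither its value at \<open>x\<close> nor the bound on its norm.\<close>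

lemma local_support_dual_norm_eq:
  assumes x: "x \<in> coord_subspace K"
  shows "local_support_dual_norm N K x = N x"
  unfolding local_support_dual_norm_def
proof (rule cSup_eq_maximum)
  obtain y where y: "dual_norm N y \<le> 1" "x \<bullet> y = N x"
    by (rule norming_functional_exists[OF norm])
  show "N x \<in> (\<lambda>y. x \<bullet> y) ` {y \<in> coord_subspace K. local_top_dual_norm N K y \<le> 1}"
  proof (rule image_eqI)
    show "N x = x \<bullet> proj K y" using y(2) x by (simp add: inner_proj_swap proj_ident)
    show "proj K y \<in> {y \<in> coord_subspace K. local_top_dual_norm N K y \<le> 1}"
      using y(1) dual_norm_proj_le[of K y]
      by (simp add: proj_in_coord_subspace local_top_dual_norm_eq proj_proj)
  qed
next
  fix v
  assume "v \<in> (\<lambda>y. x \<bullet> y) ` {y \<in> coord_subspace K. local_top_dual_norm N K y \<le> 1}"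
  then obtain y where "v = x \<bullet> y" "dual_norm N y \<le> 1"
    by (auto simp: local_top_dual_norm_eq proj_ident)
  then show "v \<le> N x"
    using inner_le_is_norm_mult_dual_norm[OF norm, of x y]
      mult_left_mono[of "dual_norm N y" 1 "N x"] is_norm_nonneg[OF norm, of x] by simp
qed

lemma mem_local_ball_iff: "x \<in> local_ball N K \<longleftrightarrow> x \<in> coord_subspace K \<and> N x \<le> 1"
proof (cases "K = {}")
  case True
  have "x \<in> coord_subspace {} \<longleftrightarrow> x = 0" by (simp add: coord_subspace_def vec_eq_iff)
  with True show ?thesis by (auto simp: local_ball_def is_norm_zero[OF norm])
qed (auto simp: local_ball_def local_support_dual_norm_eq)

lemma mem_local_sphere_iff:
  "K \<noteq> {} \<Longrightarrow> x \<in> local_sphere N K \<longleftrightarrow> x \<in> coord_subspace K \<and> N x = 1"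
  by (auto simp: local_sphere_def local_support_dual_norm_eq)

lemma mem_local_sphere_empty_iff: "x \<in> local_sphere N {} \<longleftrightarrow> x = 0"
  by (simp add: local_sphere_def)

lemma local_sphere_subset_local_ball: "local_sphere N K \<subseteq> local_ball N K"
proof (cases "K = {}")
  case False
  then show ?thesis by (simp add: subset_iff mem_local_sphere_iff mem_local_ball_iff)
qed (simp add: local_sphere_def local_ball_def)

lemma local_sphere_nonempty:
  obtains x where "x \<in> local_sphere N K"
proof (cases "K = {}")
  case False
  then obtain j where j: "j \<in> K" by blast
  have nz: "axis j (1::real) \<noteq> 0" by (simp add: axis_eq_0_iff)
  have "axis j 1 \<in> coord_subspace K" using j by (auto simp: coord_subspace_def axis_def)
  then have "axis j 1 /\<^sub>R N (axis j 1) \<in> local_sphere N K"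
    by (simp only: mem_local_sphere_iff[OF False] scaleR_in_coord_subspace is_norm_normalize[OF norm nz])
  then show thesis by (rule that)
qed (use mem_local_sphere_empty_iff that in blast)

lemma local_ball_eq: "local_ball N K = coord_subspace K \<inter> {x. N x \<le> 1}"
  by (auto simp: mem_local_ball_iff)

lemma convex_local_ball: "convex (local_ball N K)"
  unfolding local_ball_eq
  by (intro convex_Int convex_is_norm_ball norm subspace_imp_convex subspace_coord_subspace)

lemma compact_local_ball: "compact (local_ball N K)"
  unfolding local_ball_eq
  by (intro closed_Int_compact compact_is_norm_ball norm closed_subspace subspace_coord_subspace)

end


section \<open>Suprema of affine functions\<close>

lemma convex_fun_SUP_affine:
  fixes a :: "'i \<Rightarrow> real^'n"
  shows "convex_fun (\<lambda>x. SUP i. ereal (x \<bullet> a i - b i))"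
proof -
  have "{(x, t :: real). (SUP i. ereal (x \<bullet> a i - b i)) \<le> ereal t}
      = (\<Inter>i. {p. (a i, -1) \<bullet> p \<le> b i})"
    by (auto simp: SUP_le_iff inner_commute algebra_simps)
  then show ?thesis
    unfolding convex_fun_def by (simp only:) (intro convex_INT convex_halfspace_le)
qed

lemma lsc_fun_SUP_affine:
  fixes a :: "'i \<Rightarrow> real^'n"
  shows "lsc_fun (\<lambda>x. SUP i. ereal (x \<bullet> a i - b i))"
  unfolding lsc_fun_def
proof (intro allI SUP_least)
  fix x :: "real^'n" and i
  have "((\<lambda>z. ereal (z \<bullet> a i - b i)) \<longlongrightarrow> ereal (x \<bullet> a i - b i)) (at x)"
    by (intro tendsto_intros)
  then have "ereal (x \<bullet> a i - b i) = Liminf (at x) (\<lambda>z. ereal (z \<bullet> a i - b i))"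
    by (intro lim_imp_Liminf[symmetric]) auto
  also have "\<dots> \<le> Liminf (at x) (\<lambda>x. SUP i. ereal (x \<bullet> a i - b i))"
    by (intro Liminf_mono always_eventually allI SUP_upper UNIV_I)
  finally show "ereal (x \<bullet> a i - b i) \<le> Liminf (at x) (\<lambda>x. SUP i. ereal (x \<bullet> a i - b i))" .
qed

lemma convex_fun_le_convex_combination:
  fixes f :: "real^'n \<Rightarrow> ereal"
  assumes "convex_fun f" "finite I" "\<And>i. i \<in> I \<Longrightarrow> 0 \<le> l i" "sum l I = 1"
    and "\<And>i. i \<in> I \<Longrightarrow> f (z i) \<le> ereal (t i)"
  shows "f (\<Sum>i\<in>I. l i *\<^sub>R z i) \<le> ereal (\<Sum>i\<in>I. l i * t i)"
proof -
  have "(\<Sum>i\<in>I. l i *\<^sub>R (z i, t i)) \<in> {(x, t :: real). f x \<le> ereal t}"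
    using assms by (intro convex_sum) (auto simp: convex_fun_def)
  moreover have "(\<Sum>i\<in>I. l i *\<^sub>R (z i, t i)) = (\<Sum>i\<in>I. l i *\<^sub>R z i, \<Sum>i\<in>I. l i * t i)"
    using \<open>finite I\<close> by induction (simp_all add: zero_prod_def)
  ultimately show ?thesis by simp
qed


lemma is_minimumI:
  assumes lower: "\<And>a. a \<in> A \<Longrightarrow> m \<le> a" and attained: "m \<noteq> \<infinity> \<Longrightarrow> m \<in> A"
  shows "is_minimum m A"
proof (cases "A = {}")
  case False
  then obtain a where a: "a \<in> A" by blast
  have "m \<in> A"
  proof (cases "m = \<infinity>")
    case True
    then have "a = m" using lower[OF a] by simp
    with a show ?thesis by simp
  qed (rule attained)
  with False lower show ?thesis by (simp add: is_minimum_def)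
qed (use attained in \<open>auto simp: is_minimum_def\<close>)


section \<open>The biconjugate of a nondecreasing function of the support\<close>

locale projection_monotone_norm_set_fun = projection_monotone_norm N
  for N :: "real^'n \<Rightarrow> real" +
  fixes F :: "'n set \<Rightarrow> real"
  assumes mono: "mono F"
begin

text \<open>The maximum is taken over the reals, so that differences with it are never subject to the
  conventions for infinite values.\<close>

definition conj_value :: "real^'n \<Rightarrow> real" where
  "conj_value y = (MAX K. local_top_dual_norm N K y - F K)"

lemma le_conj_value: "local_top_dual_norm N K y - F K \<le> conj_value y"
  unfolding conj_value_def by (rule Max_ge) auto

lemma conj_value_le_iff: "conj_value y \<le> m \<longleftrightarrow> (\<forall>K. local_top_dual_norm N K y - F K \<le> m)"
  unfolding conj_value_def by (subst Max_le_iff) auto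

lemma SUP_local_top_dual_norm_eq:
  "(SUP K. ereal (local_top_dual_norm N K y - F K)) = ereal (conj_value y)"
proof (rule antisym)
  show "(SUP K. ereal (local_top_dual_norm N K y - F K)) \<le> ereal (conj_value y)"
    by (rule SUP_least) (simp add: le_conj_value)
  have "conj_value y \<in> range (\<lambda>K. local_top_dual_norm N K y - F K)"
    unfolding conj_value_def by (rule Max_in) auto
  then obtain K where "conj_value y = local_top_dual_norm N K y - F K" by blast
  then show "ereal (conj_value y) \<le> (SUP K. ereal (local_top_dual_norm N K y - F K))"
    by (simp only:) (rule SUP_upper, simp)
qed

text \<open>The coupling only sees \<open>x\<close> through its direction, so conjugating amounts to a supremum over
  unit vectors; monotonicity of \<open>F\<close> allows to relax \<open>supp x = K\<close> to \<open>supp x \<subseteq> K\<close>, which makes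
  the support function of a local ball appear. The term \<open>x = 0\<close> takes care of the points of a
  ball at which the inner product is negative.\<close>

lemma capra_conjugate_F_supp_eq:
  "capra_conjugate N (\<lambda>x. ereal (F (supp x))) y = ereal (conj_value y)"
proof -
  have eq: "capra_conjugate N (\<lambda>x. ereal (F (supp x))) y
      = (SUP x. ereal (capra N x y - F (supp x)))"
    by (simp add: capra_conjugate_def lower_add_def)
  show ?thesis
    unfolding eq
  proof (rule antisym)
    show "(SUP x. ereal (capra N x y - F (supp x))) \<le> ereal (conj_value y)"
    proof (rule SUP_least)
      fix x
      have "capra N x y \<le> local_top_dual_norm N (supp x) y"
      proof (cases "x = 0")
        case True
        then show ?thesis
          using inner_le_local_top_dual_norm[of 0 "supp x" y] is_norm_zero[OF norm]
          by (simp add: capra_def coord_subspace_def)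
      next
        case False
        then have "(x /\<^sub>R N x) \<bullet> y \<le> local_top_dual_norm N (supp x) y"
          using is_norm_normalize[OF norm False]
          by (intro inner_le_local_top_dual_norm scaleR_in_coord_subspace)
            (simp_all add: coord_subspace_iff_supp)
        with False show ?thesis by (simp add: capra_def divide_inverse_commute)
      qed
      then show "ereal (capra N x y - F (supp x)) \<le> ereal (conj_value y)"
        using le_conj_value[of "supp x" y] by simp
    qed
    show "ereal (conj_value y) \<le> (SUP x. ereal (capra N x y - F (supp x)))"
      unfolding SUP_local_top_dual_norm_eq[symmetric]
    proof (rule SUP_mono)
      fix K :: "'n set"
      obtain x where x: "x \<in> coord_subspace K" "N x \<le> 1" "local_top_dual_norm N K y = x \<bullet> y"
        by (rule local_top_dual_norm_attained)
      show "\<exists>x\<in>UNIV. ereal (local_top_dual_norm N K y - F K) \<le> ereal (capra N x y - F (supp x))"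
      proof (cases "x \<bullet> y \<le> 0")
        case True
        have "F (supp (0 :: real^'n)) \<le> F K" by (rule monoD[OF mono]) (simp add: supp_def)
        then show ?thesis using True x(3) by (intro bexI[of _ 0]) (simp_all add: capra_def)
      next
        case False
        then have "x \<noteq> 0" by auto
        then have "x \<bullet> y \<le> capra N x y"
          using False x(2) is_norm_pos[OF norm \<open>x \<noteq> 0\<close>] mult_left_mono[OF x(2), of "x \<bullet> y"]
          by (simp add: capra_def field_simps)
        moreover have "F (supp x) \<le> F K"
          using x(1) by (intro monoD[OF mono]) (simp add: coord_subspace_iff_supp)
        ultimately show ?thesis using x(3) by (intro bexI[of _ x]) simp_all
      qed
    qed
  qed
qed

lemma L0_eq: "L0 N F = (\<lambda>x. SUP y. ereal (x \<bullet> y - conj_value y))"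
  by (simp add: L0_def fenchel_conjugate_def[abs_def] capra_conjugate_F_supp_eq lower_add_def)

lemma L0_eq_fenchel_conjugate:
  "L0 N F = fenchel_conjugate (\<lambda>y. SUP K. ereal (local_top_dual_norm N K y - F K))"
  by (simp add: L0_def capra_conjugate_F_supp_eq[abs_def] SUP_local_top_dual_norm_eq)

lemma L0_ge: "ereal (x \<bullet> y - conj_value y) \<le> L0 N F x"
  unfolding L0_eq by (rule SUP_upper) simp

lemma L0_le_on_local_ball:
  assumes "x \<in> local_ball N K"
  shows "L0 N F x \<le> ereal (F K)"
  unfolding L0_eq
proof (rule SUP_least)
  fix y
  have "x \<bullet> y \<le> local_top_dual_norm N K y"
    using assms by (intro inner_le_local_top_dual_norm) (simp_all add: mem_local_ball_iff)
  then show "ereal (x \<bullet> y - conj_value y) \<le> ereal (F K)" using le_conj_value[of K y] by simp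
qed

lemma proper_convex_lsc_L0: "proper_convex_lsc (L0 N F)"
  unfolding proper_convex_lsc_def proper_fun_def
proof (intro conjI allI)
  show "L0 N F x \<noteq> -\<infinity>" for x using L0_ge[of x 0] by auto
  have "(0 :: real^'n) \<in> local_ball N {}" by (simp add: local_ball_def)
  then show "\<exists>x. L0 N F x \<noteq> \<infinity>" using L0_le_on_local_ball[of 0 "{}"] by (intro exI[of _ 0]) auto
  show "convex_fun (L0 N F)" unfolding L0_eq by (rule convex_fun_SUP_affine)
  show "lsc_fun (L0 N F)" unfolding L0_eq by (rule lsc_fun_SUP_affine)
qed

lemma L0_le_convex_combination:
  assumes "l \<in> simplex_weights" "\<And>K. z K \<in> local_ball N K"
  shows "L0 N F (\<Sum>K\<in>UNIV. l K *\<^sub>R z K) \<le> ereal (\<Sum>K\<in>UNIV. l K * F K)"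
proof (rule convex_fun_le_convex_combination[where f = "L0 N F" and z = z and t = F])
  show "L0 N F (z K) \<le> ereal (F K)" for K using assms(2) by (rule L0_le_on_local_ball)
next
  show "convex_fun (L0 N F)" using proper_convex_lsc_L0 by (simp only: proper_convex_lsc_def)
next
  show "0 \<le> l K" for K using assms(1) by (simp add: simplex_weights_def)
next
  show "sum l UNIV = 1" using assms(1) by (simp add: simplex_weights_def)
qed simp

text \<open>Let \<open>r = L0 N F x\<close>. The point \<open>(x, r)\<close> belongs to the closed convex set \<open>E\<close> that
  is generated by the balls placed at the heights \<open>F K\<close> and by the upward vertical direction. Indeed
  a hyperplane that strictly separates it from \<open>E\<close> yields, if it is not vertical, a
  \<open>y\<close> with \<open>x \<bullet> y - conj_value y > r\<close>. If it is vertical, its normal has a larger inner product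
  with \<open>x\<close> than with any point of the unit ball, and its multiples make \<open>L0 N F x\<close> infinite.\<close>

lemma L0_ball_decomposition:
  assumes "L0 N F x \<noteq> \<infinity>"
  obtains l z where "l \<in> simplex_weights" "\<And>K. z K \<in> local_ball N K"
    "x = (\<Sum>K\<in>UNIV. l K *\<^sub>R z K)" "ereal (\<Sum>K\<in>UNIV. l K * F K) \<le> L0 N F x"
proof -
  have "L0 N F x \<noteq> -\<infinity>"
    using proper_convex_lsc_L0 by (simp add: proper_convex_lsc_def proper_fun_def)
  with assms obtain r where r: "L0 N F x = ereal r" by (cases "L0 N F x") auto
  define S where "S K = local_ball N K \<times> {F K}" for K
  define C where "C = convex hull (\<Union>K\<in>UNIV. S K)"
  define E where "E = (\<Union>p\<in>C. \<Union>q\<in>{0} \<times> {0..}. {p + q})"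
  have S: "convex (S K)" "compact (S K)" "S K \<noteq> {}" for K
    using convex_local_ball compact_local_ball local_sphere_nonempty[of K]
      local_sphere_subset_local_ball[of K]
    by (auto simp: S_def intro!: convex_Times compact_Times)
  have E_I: "(z, F K + s) \<in> E" if "z \<in> local_ball N K" "0 \<le> s" for z K s
  proof -
    have "(z, F K) \<in> C" unfolding C_def by (rule hull_inc) (use that in \<open>auto simp: S_def\<close>)
    moreover have "(z, F K + s) = (z, F K) + (0, s)" by simp
    ultimately show ?thesis unfolding E_def using that(2) by blast
  qed
  have "(x, r) \<in> E"
  proof (rule ccontr)
    assume "(x, r) \<notin> E"
    moreover have "convex E"
      unfolding E_def C_def by (intro convex_sums convex_convex_hull convex_Times) auto
    moreover have "closed E"
      unfolding E_def C_def
      by (intro compact_closed_sums compact_convex_hull compact_UN closed_Times S ballI) auto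
    ultimately obtain a b c where
      sep: "(a, b) \<bullet> (x, r) < c" "\<And>p. p \<in> E \<Longrightarrow> c < (a, b) \<bullet> p"
      using separating_hyperplane_closed_point[of E "(x, r)"] by (metis surj_pair)
    have ball: "c < a \<bullet> z + b * (F K + s)" if "z \<in> local_ball N K" "0 \<le> s" for z K s
      using sep(2)[OF E_I[OF that]] by simp
    have "0 \<le> b"
    proof (rule ccontr)
      assume "\<not> 0 \<le> b"
      have "0 \<in> local_ball N {}" by (simp add: local_ball_def)
      \<comment> \<open>The hyperplane meets the vertical line through the origin at the height \<open>c / b\<close>, while \<open>E\<close>
        contains all the points of this line above \<open>F {}\<close>.\<close>
      moreover define s where "s = max 0 (c / b - F {})"
      ultimately have "c < b * (F {} + s)" using ball[of 0 "{}" s] by simp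
      moreover have "b * (F {} + s) \<le> b * (c / b)"
        using \<open>\<not> 0 \<le> b\<close> by (intro mult_left_mono_neg) (auto simp: s_def)
      ultimately show False using \<open>\<not> 0 \<le> b\<close> by simp
    qed
    show False
    proof (cases "b = 0")
      case False
      with \<open>0 \<le> b\<close> have b: "0 < b" by simp
      define y where "y = - (a /\<^sub>R b)"
      have "conj_value y \<le> - c / b"
        unfolding conj_value_le_iff
      proof
        fix K
        obtain z where z: "z \<in> coord_subspace K" "N z \<le> 1" "local_top_dual_norm N K y = z \<bullet> y"
          by (rule local_top_dual_norm_attained)
        have "c < a \<bullet> z + b * F K" using ball[of z K 0] z by (simp add: mem_local_ball_iff)
        then show "local_top_dual_norm N K y - F K \<le> - c / b"
          using b z(3) by (simp add: y_def field_simps inner_commute)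
      qed
      moreover have "r < x \<bullet> y + c / b"
        using sep(1) b by (simp add: y_def field_simps inner_commute)
      moreover have "x \<bullet> y - conj_value y \<le> r" using L0_ge[of x y] r by simp
      ultimately show False by simp
    next
      case True
      obtain z where z: "z \<in> coord_subspace UNIV" "N z \<le> 1"
          "local_top_dual_norm N UNIV (- a) = z \<bullet> (- a)"
        by (rule local_top_dual_norm_attained)
      define e where "e = a \<bullet> z - a \<bullet> x"
      have e: "0 < e"
        using ball[of z UNIV 0] z sep(1) True by (simp add: mem_local_ball_iff e_def)
      have le: "t * e + F {} \<le> r" if "0 \<le> t" for t
      proof -
        have "conj_value (t *\<^sub>R (- a)) \<le> t * (z \<bullet> (- a)) - F {}"
          unfolding conj_value_le_iff
        proof
          fix K
          have "local_top_dual_norm N K (- a) \<le> local_top_dual_norm N UNIV (- a)"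
            unfolding local_top_dual_norm_eq
            by (metis dual_norm_proj_le proj_proj inf_top_right)
          then have "t * local_top_dual_norm N K (- a) \<le> t * (z \<bullet> (- a))"
            using that unfolding z(3) by (rule mult_left_mono)
          moreover have "F {} \<le> F K" by (rule monoD[OF mono]) simp
          ultimately show "local_top_dual_norm N K (t *\<^sub>R (- a)) - F K \<le> t * (z \<bullet> (- a)) - F {}"
            using local_top_dual_norm_scaleR[OF that, of K "- a"] by simp
        qed
        moreover have "x \<bullet> (t *\<^sub>R (- a)) - conj_value (t *\<^sub>R (- a)) \<le> r"
          using L0_ge[of x "t *\<^sub>R (- a)"] r by simp
        ultimately show ?thesis by (simp add: e_def algebra_simps inner_commute)
      qed
      have "F {} \<le> r" using le[of 0] by simp
      then show False using le[of "(r - F {} + 1) / e"] e by simp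
    qed
  qed
  then obtain v s where vs: "(x, v) \<in> C" "0 \<le> s" "r = v + s"
    unfolding E_def by auto
  then obtain l p where lp: "(x, v) = (\<Sum>K\<in>UNIV. l K *\<^sub>R p K)" "\<And>K. 0 \<le> l K" "sum l UNIV = 1"
      "\<And>K. p K \<in> S K"
    unfolding C_def using convex_hull_finite_union[of UNIV S] S by auto
  show thesis
  proof (rule that)
    show "l \<in> simplex_weights" using lp by (simp add: simplex_weights_def)
    show "fst (p K) \<in> local_ball N K" for K using lp(4)[of K] by (auto simp: S_def)
    show "x = (\<Sum>K\<in>UNIV. l K *\<^sub>R fst (p K))"
      using arg_cong[OF lp(1), of fst] by (simp add: fst_sum)
    have "snd (p K) = F K" for K using lp(4)[of K] by (auto simp: S_def)
    then have "v = (\<Sum>K\<in>UNIV. l K * F K)"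
      using arg_cong[OF lp(1), of snd] by (simp add: snd_sum)
    then show "ereal (\<Sum>K\<in>UNIV. l K * F K) \<le> L0 N F x" using vs r by simp
  qed
qed

text \<open>Spheres suffice: a vector \<open>z K\<close> of the ball is \<open>N (z K)\<close> times a unit vector, and the weight
  thus saved goes to the empty set, where the sphere is \<open>{0}\<close> and \<open>F\<close> is smallest.\<close>

lemma L0_sphere_decomposition:
  assumes "L0 N F x \<noteq> \<infinity>"
  obtains l z where "l \<in> simplex_weights" "\<And>K. z K \<in> local_sphere N K"
    "x = (\<Sum>K\<in>UNIV. l K *\<^sub>R z K)" "L0 N F x = ereal (\<Sum>K\<in>UNIV. l K * F K)"
proof -
  obtain l z where l: "l \<in> simplex_weights" and z: "\<And>K. z K \<in> local_ball N K"
    and x: "x = (\<Sum>K\<in>UNIV. l K *\<^sub>R z K)" and le: "ereal (\<Sum>K\<in>UNIV. l K * F K) \<le> L0 N F x"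
    using L0_ball_decomposition[OF assms] by metis
  have l0: "0 \<le> l K" and l1: "sum l UNIV = 1" for K using l by (auto simp: simplex_weights_def)
  have z0: "z {} = 0" using z[of "{}"] by (simp add: local_ball_def)
  define m where "m K = l K * N (z K)" for K
  define l' where "l' K = (if K = {} then 1 - sum m UNIV else m K)" for K
  define u where "u K = (if z K = 0 then SOME v. v \<in> local_sphere N K else z K /\<^sub>R N (z K))" for K
  have m_empty: "m {} = 0" by (simp add: m_def z0 is_norm_zero[OF norm])
  have m_le: "m K \<le> l K" for K
    using z[of K] l0[of K] mult_left_mono[of "N (z K)" 1 "l K"] by (simp add: m_def mem_local_ball_iff)
  have sum_m: "sum m UNIV \<le> 1" using l1 sum_mono[of UNIV m l] m_le by simp
  \<comment> \<open>in this form a sum with the weights \<open>l'\<close> splits off the term of the empty set\<close>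
  have l'_eq: "l' K = m K + (if K = {} then 1 - sum m UNIV else 0)" for K
    by (simp add: l'_def m_empty)
  have l': "l' \<in> simplex_weights"
    using sum_m l0 is_norm_nonneg[OF norm]
    by (auto simp: simplex_weights_def l'_eq sum.distrib m_def)
  have u: "u K \<in> local_sphere N K" for K
  proof (cases "z K = 0")
    case True
    obtain v where "v \<in> local_sphere N K" by (rule local_sphere_nonempty)
    then have "(SOME v. v \<in> local_sphere N K) \<in> local_sphere N K" by (rule someI)
    with True show ?thesis by (simp add: u_def)
  next
    case False
    then have "K \<noteq> {}" using z0 by auto
    then show ?thesis
      using False z[of K] is_norm_normalize[OF norm False]
      by (simp add: u_def mem_local_sphere_iff mem_local_ball_iff scaleR_in_coord_subspace)
  qed
  have mu: "m K *\<^sub>R u K = l K *\<^sub>R z K" for K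
    using is_norm_eq_0[OF norm, of "z K"]
    by (cases "z K = 0") (simp_all add: m_def u_def right_inverse)
  have u0: "u {} = 0" using u[of "{}"] by (simp add: mem_local_sphere_empty_iff)
  have "l' K *\<^sub>R u K = l K *\<^sub>R z K" for K
    using mu[of K] u0 z0 by (cases "K = {}") (simp_all add: l'_def)
  then have x': "x = (\<Sum>K\<in>UNIV. l' K *\<^sub>R u K)" using x by simp
  have "(\<Sum>K\<in>UNIV. l' K * F K) = (\<Sum>K\<in>UNIV. m K * F K) + (1 - sum m UNIV) * F {}"
    by (simp add: l'_eq distrib_right sum.distrib if_distrib[of "\<lambda>t. t * _"] cong: if_cong)
  also have "\<dots> = (\<Sum>K\<in>UNIV. m K * F K) + (\<Sum>K\<in>UNIV. (l K - m K) * F {})"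
    by (simp add: l1 sum_subtractf flip: sum_distrib_right)
  also have "\<dots> \<le> (\<Sum>K\<in>UNIV. m K * F K) + (\<Sum>K\<in>UNIV. (l K - m K) * F K)"
    using m_le monoD[OF mono, of "{}"] by (intro add_left_mono sum_mono mult_left_mono) auto
  also have "\<dots> = (\<Sum>K\<in>UNIV. l K * F K)"
    by (simp add: algebra_simps flip: sum.distrib)
  finally have "ereal (\<Sum>K\<in>UNIV. l' K * F K) \<le> L0 N F x" using le
    by (meson ereal_less_eq(3) order_trans)
  moreover have "L0 N F x \<le> ereal (\<Sum>K\<in>UNIV. l' K * F K)"
    unfolding x' using l' u local_sphere_subset_local_ball by (intro L0_le_convex_combination) auto
  ultimately show thesis using that[OF l' u x'] by simp
qed

text \<open>The argument squeezes: being below the constants on the balls is the strongest requirement and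
  holds for \<open>L0 N F\<close>, being below them on the spheres is the weakest and already forces a convex
  function below \<open>L0 N F\<close>. Any family \<open>A\<close> in between gives the same envelope.\<close>

lemma largest_proper_convex_lsc_below_L0:
  assumes "\<And>K. local_sphere N K \<subseteq> A K" "\<And>K. A K \<subseteq> local_ball N K"
  shows "largest_proper_convex_lsc_below (L0 N F) (\<lambda>x. INF K\<in>{K. x \<in> A K}. ereal (F K))"
  unfolding largest_proper_convex_lsc_below_def
proof (intro conjI allI impI)
  show "proper_convex_lsc (L0 N F)" by (rule proper_convex_lsc_L0)
  show "L0 N F \<le> (\<lambda>x. INF K\<in>{K. x \<in> A K}. ereal (F K))"
    using assms(2) by (auto simp: le_fun_def intro!: INF_greatest L0_le_on_local_ball)
next
  fix h :: "real^'n \<Rightarrow> ereal"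
  assume h: "proper_convex_lsc h \<and> h \<le> (\<lambda>x. INF K\<in>{K. x \<in> A K}. ereal (F K))"
  have on_sphere: "h z \<le> ereal (F K)" if "z \<in> local_sphere N K" for z K
  proof -
    have "h z \<le> (INF K\<in>{K. z \<in> A K}. ereal (F K))" using h by (simp add: le_fun_def)
    also have "\<dots> \<le> ereal (F K)" using that assms(1) by (intro INF_lower) auto
    finally show ?thesis .
  qed
  show "h \<le> L0 N F"
  proof (rule le_funI)
    fix x
    show "h x \<le> L0 N F x"
    proof (cases "L0 N F x = \<infinity>")
      case False
      then obtain l z where lz: "l \<in> simplex_weights" "\<And>K. z K \<in> local_sphere N K"
          "x = (\<Sum>K\<in>UNIV. l K *\<^sub>R z K)" "L0 N F x = ereal (\<Sum>K\<in>UNIV. l K * F K)"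
        using L0_sphere_decomposition[OF False] by metis
      have "h (\<Sum>K\<in>UNIV. l K *\<^sub>R z K) \<le> ereal (\<Sum>K\<in>UNIV. l K * F K)"
      proof (rule convex_fun_le_convex_combination[where f = h and z = z and t = F])
        show "h (z K) \<le> ereal (F K)" for K using lz(2) by (rule on_sphere)
      qed (use h lz(1) in \<open>auto simp: simplex_weights_def proper_convex_lsc_def\<close>)
      then show ?thesis unfolding lz(3)[symmetric] lz(4) .
    qed simp
  qed
qed

lemma is_minimum_L0_weights:
  assumes "\<And>K. local_sphere N K \<subseteq> A K" "\<And>K. A K \<subseteq> local_ball N K"
  shows "is_minimum (L0 N F x)
    {ereal (\<Sum>K\<in>UNIV. l K * F K) | l. l \<in> simplex_weights \<and> x \<in> weighted_set_sum l A}"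
    (is "is_minimum _ ?M")
proof -
  have mem: "x \<in> weighted_set_sum l A \<longleftrightarrow> (\<exists>z. (\<forall>K. z K \<in> A K) \<and> x = (\<Sum>K\<in>UNIV. l K *\<^sub>R z K))" for l
  proof -
    have "x \<in> weighted_set_sum l A
        \<longleftrightarrow> (\<exists>w. x = sum w UNIV \<and> (\<forall>K. \<exists>z\<in>A K. w K = l K *\<^sub>R z))"
      unfolding weighted_set_sum_def by (subst set_sum_alt) (auto simp: image_iff)
    also have "\<dots> \<longleftrightarrow> (\<exists>z. (\<forall>K. z K \<in> A K) \<and> x = (\<Sum>K\<in>UNIV. l K *\<^sub>R z K))"
      unfolding Bex_def choice_iff by (auto intro!: sum.cong)
    finally show ?thesis .
  qed
  have lower: "L0 N F x \<le> a" if "a \<in> ?M" for a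
    using that assms(2) by (auto simp: mem intro!: L0_le_convex_combination)
  have attained: "L0 N F x \<in> ?M" if fin: "L0 N F x \<noteq> \<infinity>"
  proof -
    obtain l z where l: "l \<in> simplex_weights" and z: "\<And>K. z K \<in> local_sphere N K"
      and x: "x = (\<Sum>K\<in>UNIV. l K *\<^sub>R z K)" and L0x: "L0 N F x = ereal (\<Sum>K\<in>UNIV. l K * F K)"
      using L0_sphere_decomposition[OF fin] by metis
    have "x \<in> weighted_set_sum l A" unfolding mem using z x assms(1) by blast
    with l L0x show ?thesis by blast
  qed
  from lower attained show ?thesis by (rule is_minimumI)
qed

text \<open>A family of vectors \<open>z K\<close> with total norm at most \<open>1\<close> is a convex combination of unit vectors
  with weights \<open>N (z K)\<close>; the remaining weight goes to the empty set, free of charge when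
  \<open>F {} = 0\<close>.\<close>

lemma is_minimum_L0_decompositions:
  assumes F0: "F {} = 0"
  shows "is_minimum (L0 N F x)
    {ereal (\<Sum>K\<in>-{{}}. local_support_dual_norm N K (z K) * F K) | z. z \<in> decompositions N x}"
    (is "is_minimum _ ?M")
proof -
  have sum_split: "sum f UNIV = f {} + sum f (-{{}})" for f :: "'n set \<Rightarrow> 'a::comm_monoid_add"
    using sum.remove[of UNIV "{}" f] by (simp add: Compl_eq_Diff_UNIV)
  have lower: "L0 N F x \<le> a" if "a \<in> ?M" for a
  proof -
    from that obtain z where a: "a = ereal (\<Sum>K\<in>-{{}}. local_support_dual_norm N K (z K) * F K)"
      and z: "z \<in> decompositions N x" by blast
    have zK: "z K \<in> coord_subspace K" if "K \<noteq> {}" for K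
      using z that by (simp add: decompositions_def)
    have eq: "local_support_dual_norm N K (z K) = N (z K)" if "K \<in> -{{}}" for K
      using that zK by (simp add: local_support_dual_norm_eq)
    have sum_le: "(\<Sum>K\<in>-{{}}. N (z K)) \<le> 1" and x: "(\<Sum>K\<in>-{{}}. z K) = x"
      using z by (simp_all add: decompositions_def eq cong: sum.cong_simp)
    define l where "l K = (if K = {} then 1 - (\<Sum>K\<in>-{{}}. N (z K)) else N (z K))" for K
    define u where "u K = (if K = {} then 0 else z K /\<^sub>R N (z K))" for K
    have "l \<in> simplex_weights"
      using sum_le by (auto simp: simplex_weights_def sum_split l_def is_norm_nonneg[OF norm])
    moreover have "u K \<in> local_ball N K" for K
    proof (cases "K = {} \<or> z K = 0")
      case True
      then show ?thesis
        by (auto simp: mem_local_ball_iff u_def coord_subspace_def is_norm_zero[OF norm])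
    next
      case False
      then show ?thesis
        using zK is_norm_normalize[OF norm, of "z K"]
        by (simp add: mem_local_ball_iff u_def scaleR_in_coord_subspace)
    qed
    ultimately have "L0 N F (\<Sum>K\<in>UNIV. l K *\<^sub>R u K) \<le> ereal (\<Sum>K\<in>UNIV. l K * F K)"
      by (rule L0_le_convex_combination)
    moreover have "(\<Sum>K\<in>UNIV. l K *\<^sub>R u K) = x"
    proof -
      have "l K *\<^sub>R u K = z K" if "K \<in> -{{}}" for K
        using that is_norm_eq_0[OF norm, of "z K"]
        by (cases "z K = 0") (simp_all add: l_def u_def right_inverse)
      then show ?thesis using x by (simp add: sum_split u_def[of "{}"])
    qed
    moreover have "(\<Sum>K\<in>UNIV. l K * F K) = (\<Sum>K\<in>-{{}}. local_support_dual_norm N K (z K) * F K)"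
      unfolding sum_split using F0 eq by (auto simp: l_def intro!: sum.cong)
    ultimately show ?thesis by (simp add: a)
  qed
  have attained: "L0 N F x \<in> ?M" if fin: "L0 N F x \<noteq> \<infinity>"
  proof -
    obtain l z where l: "l \<in> simplex_weights" and z: "\<And>K. z K \<in> local_sphere N K"
      and x: "x = (\<Sum>K\<in>UNIV. l K *\<^sub>R z K)" and L0x: "L0 N F x = ereal (\<Sum>K\<in>UNIV. l K * F K)"
      using L0_sphere_decomposition[OF fin] by metis
    have l0: "0 \<le> l K" for K using l by (auto simp: simplex_weights_def)
    have zK: "z K \<in> coord_subspace K \<and> N (z K) = 1" if "K \<noteq> {}" for K
      using z[of K] that by (simp add: mem_local_sphere_iff)
    have eq: "local_support_dual_norm N K (l K *\<^sub>R z K) = l K" if "K \<in> -{{}}" for K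
      using that zK[of K] l0[of K]
      by (simp add: local_support_dual_norm_eq scaleR_in_coord_subspace is_norm_scaleR[OF norm])
    have "z {} = 0" using z[of "{}"] by (simp add: mem_local_sphere_empty_iff)
    then have "(\<Sum>K\<in>-{{}}. l K *\<^sub>R z K) = x" using x by (simp add: sum_split)
    moreover have "l {} + (\<Sum>K\<in>-{{}}. l K) = 1"
      using l by (simp add: simplex_weights_def flip: sum_split)
    then have "(\<Sum>K\<in>-{{}}. l K) \<le> 1" using l0[of "{}"] by linarith
    ultimately have "(\<lambda>K. l K *\<^sub>R z K) \<in> decompositions N x"
      using zK by (simp add: decompositions_def scaleR_in_coord_subspace eq cong: sum.cong_simp)
    moreover have "(\<Sum>K\<in>UNIV. l K * F K)
        = (\<Sum>K\<in>-{{}}. local_support_dual_norm N K (l K *\<^sub>R z K) * F K)"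
      unfolding sum_split using F0 eq by (auto intro!: sum.cong)
    ultimately show ?thesis using L0x by fastforce
  qed
  from lower attained show ?thesis by (rule is_minimumI)
qed

end


section \<open>Values on the unit sphere\<close>

text \<open>A nonzero coordinate of \<open>x\<close> at which the norming functional vanishes could be halved, which
  decreases the norm of \<open>x\<close> but leaves the inner product equal to the former norm.\<close>

lemma supp_subset_supp_norming_functional:
  fixes N :: "real^'n \<Rightarrow> real"
  assumes "is_norm N" "orthant_strictly_monotonic N" "dual_norm N y \<le> 1" "x \<bullet> y = N x"
  shows "supp x \<subseteq> supp y"
proof (rule ccontr)
  assume "\<not> supp x \<subseteq> supp y"
  then obtain j where j: "x $ j \<noteq> 0" "y $ j = 0" by (auto simp: supp_def)
  define x' :: "real^'n" where "x' = (\<chi> i. if i = j then x $ i / 2 else x $ i)"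
  have "N x' < N x"
    by (rule orthant_strictly_monotonicD[OF assms(2), where j = j])
      (use j in \<open>auto simp: x'_def abs_mult_self_eq\<close>)
  moreover have "x' \<bullet> y = x \<bullet> y"
    using j(2) by (auto simp: inner_vec_def x'_def intro!: sum.cong)
  moreover have "x' \<bullet> y \<le> N x'"
    using inner_le_is_norm_mult_dual_norm[OF assms(1), of x' y]
      mult_left_mono[OF assms(3) is_norm_nonneg[OF assms(1), of x']] by simp
  ultimately show False using assms(4) by simp
qed

text \<open>Let \<open>y\<close> be a norming functional of \<open>x\<close> with the same support. Strict monotonicity of the dual
  norm makes the local top norm of \<open>y\<close> less than \<open>1\<close> for every \<open>K\<close> that does not contain
  the support of \<open>x\<close>, so that for large \<open>t\<close> the affine function given by \<open>t *\<^sub>R y\<close> has the value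
  \<open>F (supp x)\<close> at \<open>x\<close>.\<close>

lemma (in projection_monotone_norm_set_fun) L0_eq_on_unit_sphere:
  assumes "orthant_strictly_monotonic N" "orthant_strictly_monotonic (dual_norm N)" and x: "N x = 1"
  shows "L0 N F x = ereal (F (supp x))"
proof (rule antisym)
  show "L0 N F x \<le> ereal (F (supp x))"
    using x by (intro L0_le_on_local_ball) (simp add: mem_local_ball_iff coord_subspace_iff_supp)
  obtain y' where y': "dual_norm N y' \<le> 1" "x \<bullet> y' = N x"
    by (rule norming_functional_exists[OF norm])
  define y where "y = proj (supp x) y'"
  have y: "dual_norm N y \<le> 1" "x \<bullet> y = 1"
    using y' dual_norm_proj_le[of "supp x" y'] x
    by (simp_all add: y_def inner_proj_swap proj_ident coord_subspace_iff_supp)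
  have supp_y: "supp x \<subseteq> supp y"
    using y x by (intro supp_subset_supp_norming_functional[OF norm assms(1)]) simp_all
  have less: "local_top_dual_norm N K y < 1" if "\<not> supp x \<subseteq> K" for K
  proof -
    have "dual_norm N (proj K y) < dual_norm N y"
      using that supp_y by (intro orthant_strictly_monotonic_proj_less[OF assms(2)]) blast
    with y(1) show ?thesis by (simp add: local_top_dual_norm_eq)
  qed
  have le: "local_top_dual_norm N K y \<le> 1" for K
    using dual_norm_proj_le[of K y] y(1) by (simp add: local_top_dual_norm_eq)
  \<comment> \<open>When \<open>supp x\<close> is not contained in \<open>K\<close>, the term of \<open>K\<close> in \<open>conj_value (t *\<^sub>R y)\<close> is at most
    \<open>t - F (supp x)\<close> as soon as \<open>t\<close> is at least \<open>q K\<close>; otherwise the denominator vanishes and \<open>q K\<close>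
    is \<open>0\<close>.\<close>
  define q where "q K = (F (supp x) - F K) / (1 - local_top_dual_norm N K y)" for K
  define t where "t = Max (insert 0 (range q))"
  have t: "0 \<le> t" "q K \<le> t" for K unfolding t_def by (rule Max_ge; simp)+
  have "conj_value (t *\<^sub>R y) \<le> t - F (supp x)"
    unfolding conj_value_le_iff
  proof
    fix K
    have "t * local_top_dual_norm N K y - F K \<le> t - F (supp x)"
    proof (cases "supp x \<subseteq> K")
      case True
      then have "F (supp x) \<le> F K" by (rule monoD[OF mono])
      moreover have "t * local_top_dual_norm N K y \<le> t" using mult_left_mono[OF le t(1), of K] by simp
      ultimately show ?thesis by simp
    next
      case False
      then have "F (supp x) - F K \<le> t * (1 - local_top_dual_norm N K y)"
        using t(2)[of K] less[of K] by (simp add: q_def pos_divide_le_eq)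
      then show ?thesis by (simp add: algebra_simps)
    qed
    then show "local_top_dual_norm N K (t *\<^sub>R y) - F K \<le> t - F (supp x)"
      using t(1) by (simp add: local_top_dual_norm_scaleR)
  qed
  then have "ereal (F (supp x)) \<le> ereal (x \<bullet> (t *\<^sub>R y) - conj_value (t *\<^sub>R y))"
    using y(2) by simp
  also have "\<dots> \<le> L0 N F x" by (rule L0_ge)
  finally show "ereal (F (supp x)) \<le> L0 N F x" .
qed


theorem proposition15:
  fixes N :: "real^'n \<Rightarrow> real" and F :: "'n set \<Rightarrow> real"
  assumes "is_norm N"
    and "orthant_strictly_monotonic N"
    and "orthant_strictly_monotonic (dual_norm N)"
    and "mono F"
  shows "proper_convex_lsc (L0 N F)
    \<and> (\<forall>x. N x = 1 \<longrightarrow> ereal (F (supp x)) = L0 N F x)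
    \<and> (\<forall>x. x \<noteq> 0 \<longrightarrow> ereal (F (supp x)) = L0 N F (x /\<^sub>R N x))
    \<and> L0 N F = fenchel_conjugate (\<lambda>y. SUP K. ereal (local_top_dual_norm N K y - F K))
    \<and> largest_proper_convex_lsc_below (L0 N F) (\<lambda>x. INF K\<in>{K. x \<in> local_ball N K}. ereal (F K))
    \<and> largest_proper_convex_lsc_below (L0 N F) (\<lambda>x. INF K\<in>{K. x \<in> local_sphere N K}. ereal (F K))
    \<and> (\<forall>x. is_minimum (L0 N F x)
          {ereal (\<Sum>K\<in>UNIV. l K * F K) | l.
             l \<in> simplex_weights \<and> x \<in> weighted_set_sum l (local_ball N)})
    \<and> (\<forall>x. is_minimum (L0 N F x)
          {ereal (\<Sum>K\<in>UNIV. l K * F K) | l.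
             l \<in> simplex_weights \<and> x \<in> weighted_set_sum l (local_sphere N)})
    \<and> (F {} = 0 \<longrightarrow> (\<forall>x. is_minimum (L0 N F x)
          {ereal (\<Sum>K\<in>-{{}}. local_support_dual_norm N K (z K) * F K) | z.
             z \<in> decompositions N x}))"
proof -
  interpret projection_monotone_norm_set_fun N F
    using assms orthant_strictly_monotonic_proj_le[OF assms(2)] by unfold_locales
  have scaled: "ereal (F (supp x)) = L0 N F (x /\<^sub>R N x)" if "x \<noteq> 0" for x
  proof -
    have "supp (x /\<^sub>R N x) = supp x"
      using is_norm_pos[OF norm that] by (simp add: supp_def)
    then show ?thesis
      using L0_eq_on_unit_sphere[OF assms(2,3) is_norm_normalize[OF norm that]] by simp
  qed
  show ?thesis
    using L0_eq_on_unit_sphere[OF assms(2,3)]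
    by (intro conjI allI impI proper_convex_lsc_L0 scaled L0_eq_fenchel_conjugate
        largest_proper_convex_lsc_below_L0 is_minimum_L0_weights is_minimum_L0_decompositions
        local_sphere_subset_local_ball order_refl) simp_all
qed

end
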